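(* Let $p:\mathbb{R}^n\to\mathbb{R}$ be a cubic polynomial, and let $p_3$ denote its cubic homogeneous component. A point $\bar{x}\in\mathbb{R}^n$ is a local minimum of $p$ if and only if the following three conditions hold: \begin{itemize} \item $\nabla p(\bar{x})=0$, \item $\nabla^2 p(\bar{x})\succeq 0$, \item $\nabla p_3(d)=0$ for all $d\in\mathcal{N}(\nabla^2 p(\bar{x}))$. \end{itemize}
   Context: A cubic polynomial is a real polynomial all of whose monomials have degree at most 3. $p_3$ is the sum of the terms of $p$ of degree exactly 3. $\mathcal{N}(M)$ is the null space of a matrix $M$, and $M\succeq 0$ means $M$ is symmetric positive semidefinite. A point $\bar x$ is a local minimum of $p$ if there is $\epsilon>0$ such that $p(\bar x)\le p(y)$ for all $y$ with $\|y-\bar x\|\le\epsilon$ (the inequality need not be strict). *)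

theory Defs
  imports "HOL-Analysis.Analysis" "HOL-Library.Poly_Mapping"
begin

text \<open>
  Real polynomials in variables indexed by the finite type \<open>'n\<close> are finitely supported maps from
  exponent vectors (monomials) to coefficients. So \<open>keys p\<close> is the set of monomials that occur in
  \<open>p\<close> with nonzero coefficient.
\<close>

type_synonym 'n monomial = "'n \<Rightarrow>\<^sub>0 nat"

type_synonym 'n real_mpoly = "'n monomial \<Rightarrow>\<^sub>0 real"

definition monomial_degree :: "'n::finite monomial \<Rightarrow> nat"
  where "monomial_degree m = (\<Sum>i\<in>UNIV. Poly_Mapping.lookup m i)"

definition mpoly_eval :: "'n::finite real_mpoly \<Rightarrow> real ^ 'n \<Rightarrow> real"
  where "mpoly_eval p x = (\<Sum>m\<in>Poly_Mapping.keys p.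
    Poly_Mapping.lookup p m * (\<Prod>i\<in>UNIV. (x $ i) ^ Poly_Mapping.lookup m i))"

definition cubic_mpoly :: "'n::finite real_mpoly \<Rightarrow> bool"
  where "cubic_mpoly p \<longleftrightarrow> (\<forall>m\<in>Poly_Mapping.keys p. monomial_degree m \<le> 3)"

definition homogeneous_component :: "nat \<Rightarrow> 'n::finite real_mpoly \<Rightarrow> 'n real_mpoly"
  where "homogeneous_component k p =
    (\<Sum>m\<in>{m \<in> Poly_Mapping.keys p. monomial_degree m = k}.
      Poly_Mapping.single m (Poly_Mapping.lookup p m))"

text \<open>
  The gradient is only meaningful at points of differentiability, where it is the unique vector
  in the library's relation \<open>GDERIV\<close>.
\<close>

definition gradient :: "(real ^ 'n \<Rightarrow> real) \<Rightarrow> real ^ 'n \<Rightarrow> real ^ 'n"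
  where "gradient f x = (THE D. GDERIV f x :> D)"

lemma gradient_eqI:
  assumes "GDERIV f x :> D"
  shows "gradient f x = D"
  unfolding gradient_def
proof (rule the_equality)
  show "GDERIV f x :> D" by fact
next
  fix E assume "GDERIV f x :> E"
  then have "(\<lambda>h. h \<bullet> E) = (\<lambda>h. h \<bullet> D)"
    using assms has_derivative_unique unfolding gderiv_def by blast
  then have "(E - D) \<bullet> E = (E - D) \<bullet> D"
    by (rule fun_cong)
  then have "(E - D) \<bullet> (E - D) = 0"
    by (simp only: inner_diff_right)
  then show "E = D"
    by simp
qed

text \<open>Entry \<open>(i, j)\<close> is the partial derivative with respect to \<open>j\<close> of the \<open>i\<close>-th component of the
  gradient.\<close>

definition hessian :: "(real ^ 'n \<Rightarrow> real) \<Rightarrow> real ^ 'n \<Rightarrow> real ^ 'n ^ 'n"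
  where "hessian f x = jacobian (gradient f) (at x)"

definition pos_semidef :: "real ^ 'n ^ 'n \<Rightarrow> bool"
  where "pos_semidef A \<longleftrightarrow> transpose A = A \<and> (\<forall>v. 0 \<le> v \<bullet> (A *v v))"

definition null_space :: "real ^ 'n ^ 'm \<Rightarrow> (real ^ 'n) set"
  where "null_space A = {v. A *v v = 0}"

definition local_minimum :: "(real ^ 'n \<Rightarrow> real) \<Rightarrow> real ^ 'n \<Rightarrow> bool"
  where "local_minimum f x \<longleftrightarrow> (\<exists>\<epsilon>>0. \<forall>y. norm (y - x) \<le> \<epsilon> \<longrightarrow> f x \<le> f y)"

end

theory Submission
  imports Defs
begin

text \<open>
  With \<open>p\<^sub>3(h) = h \<bullet> K h h\<close> for a symmetric bilinear map \<open>K\<close>, the Taylor expansion of \<open>p\<close> at \<open>x\<close> is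
  \<open>p(x + h) = p(x) + g \<bullet> h + (h \<bullet> A h) / 2 + h \<bullet> K h h\<close>.

  Necessity: along \<open>h = t d\<close> one gets \<open>g = 0\<close>, \<open>A \<succeq> 0\<close> and \<open>d \<bullet> K d d = 0\<close> for \<open>A d = 0\<close>. Along the
  parabola \<open>h = t d + s t\<^sup>2 z\<close> the leading term is then
  \<open>t\<^sup>4 (s\<^sup>2 (z \<bullet> A z) / 2 + 3 s (z \<bullet> K d d))\<close>, which is nonnegative for all \<open>s\<close> only if
  \<open>z \<bullet> K d d = 0\<close>.

  Sufficiency: split \<open>h = d + r\<close> with \<open>A d = 0\<close> and \<open>r\<close> orthogonal to the kernel of \<open>A\<close>. All terms
  of the cubic part of order at most one in \<open>r\<close> vanish, so that part is \<open>O(\<bar>h\<bar> \<bar>r\<bar>\<^sup>2)\<close>, while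
  \<open>h \<bullet> A h = r \<bullet> A r\<close> is at least a positive multiple of \<open>\<bar>r\<bar>\<^sup>2\<close>.
\<close>

section \<open>Symmetric cubic forms\<close>

text \<open>The two laws make the trilinear form \<open>x \<bullet> K y z\<close> invariant under
  all permutations of its arguments. Working with the vector \<open>K y z\<close> rather than with
  the form keeps the gradient at hand: that of the cube at \<open>d\<close> is
  \<open>3 *\<^sub>R K d d\<close>.\<close>

locale cubic_form = bounded_bilinear K
  for K :: "'a::euclidean_space \<Rightarrow> 'a \<Rightarrow> 'a" +
  assumes commute: "K y z = K z y"
    and adjoint: "x \<bullet> K y z = y \<bullet> K x z"
begin

text \<open>By total symmetry the six mixed terms fall into two groups of three equal ones.\<close>

lemma cube_add:
  "(x + h) \<bullet> K (x + h) (x + h) = x \<bullet> K x x + 3 * (h \<bullet> K x x) + 3 * (x \<bullet> K h h) + h \<bullet> K h h"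
proof -
  have "x \<bullet> K x h = h \<bullet> K x x" "x \<bullet> K h x = h \<bullet> K x x"
    using commute[of h x] adjoint[of x h x] by simp_all
  moreover have "h \<bullet> K x h = x \<bullet> K h h" "h \<bullet> K h x = x \<bullet> K h h"
    using commute[of h x] adjoint[of h x h] by simp_all
  ultimately show ?thesis
    by (simp add: add_left add_right inner_add_left inner_add_right)
qed

lemma cube_scaleR: "(t *\<^sub>R x) \<bullet> K (t *\<^sub>R x) (t *\<^sub>R x) = t ^ 3 * (x \<bullet> K x x)"
  by (simp add: scaleR_left scaleR_right power3_eq_cube)

lemma has_derivative_cube:
  "((\<lambda>y. y \<bullet> K y y) has_derivative (\<lambda>h. 3 * (h \<bullet> K x x))) (at x)"
proof -
  have "((\<lambda>y. y \<bullet> K y y) has_derivative (\<lambda>h. x \<bullet> (K x h + K h x) + h \<bullet> K x x)) (at x)"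
    by (intro has_derivative_inner FDERIV has_derivative_ident)
  moreover have "x \<bullet> K x h = h \<bullet> K x x" "x \<bullet> K h x = h \<bullet> K x x" for h
    using commute[of h x] adjoint[of x h x] by simp_all
  then have "(\<lambda>h. x \<bullet> (K x h + K h x) + h \<bullet> K x x) = (\<lambda>h. 3 * (h \<bullet> K x x))"
    by (simp add: inner_add_right)
  ultimately show ?thesis by simp
qed

end

text \<open>Linearity in the first argument carries over to the second by commutativity, and in
  finite dimension a bilinear map is bounded.\<close>

lemma cubic_formI:
  fixes K :: "'a::euclidean_space \<Rightarrow> 'a \<Rightarrow> 'a"
  assumes "\<And>y z. K y z = K z y" and "\<And>x y z. x \<bullet> K y z = y \<bullet> K x z"
    and "\<And>y y' z. K (y + y') z = K y z + K y' z" and "\<And>c y z. K (c *\<^sub>R y) z = c *\<^sub>R K y z"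
  shows "cubic_form K"
proof -
  have "linear (\<lambda>y. K y z)" for z
    using assms(3,4) by (intro linearI)
  moreover from this have "linear (K y)" for y
    using assms(1) by (metis ext)
  ultimately have "bounded_bilinear K"
    by (simp add: bilinear_conv_bounded_bilinear[symmetric] bilinear_def)
  then show ?thesis
    using assms(1,2) unfolding cubic_form_def cubic_form_axioms_def by blast
qed

lemma cubic_form_zero: "cubic_form (\<lambda>y z. 0)"
  by (rule cubic_formI) simp_all

lemma cubic_form_add:
  assumes "cubic_form K" "cubic_form L"
  shows "cubic_form (\<lambda>y z. K y z + L y z)"
proof -
  interpret K: cubic_form K by fact
  interpret L: cubic_form L by fact
  show ?thesis
  proof (rule cubic_formI)
    show "K y z + L y z = K z y + L z y" for y z
      by (simp only: K.commute[of y] L.commute[of y])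
    show "x \<bullet> (K y z + L y z) = y \<bullet> (K x z + L x z)" for x y z
      by (simp only: inner_add_right K.adjoint[of x] L.adjoint[of x])
  qed (simp_all add: K.add_left L.add_left K.scaleR_left L.scaleR_left scaleR_add_right)
qed

lemma cubic_form_scaleR:
  assumes "cubic_form K"
  shows "cubic_form (\<lambda>y z. c *\<^sub>R K y z)"
proof -
  interpret cubic_form K by fact
  show ?thesis
  proof (rule cubic_formI)
    show "c *\<^sub>R K y z = c *\<^sub>R K z y" for y z
      by (simp only: commute[of y])
    show "x \<bullet> c *\<^sub>R K y z = y \<bullet> c *\<^sub>R K x z" for x y z
      by (simp only: inner_scaleR_right adjoint[of x])
  qed (simp_all add: add_left scaleR_left scaleR_add_right)
qed

section \<open>The optimality conditions for a cubic Taylor expansion\<close>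

text \<open>Let \<open>t\<close> tend to 0 from the right. This reads off the sign of a leading
  coefficient once the leading power of \<open>t\<close> has been divided out.\<close>

lemma nonneg_of_eventually_quadratic_nonneg:
  fixes a b c :: real
  assumes "\<forall>\<^sub>F t in at_right 0. 0 \<le> a + t * b + t\<^sup>2 * c"
  shows "0 \<le> a"
proof -
  have "((\<lambda>t. a + t * b + t\<^sup>2 * c) \<longlongrightarrow> a + 0 * b + 0\<^sup>2 * c) (at_right 0)"
    by (intro tendsto_intros)
  then show ?thesis
    using tendsto_lowerbound[OF _ assms] by simp
qed

text \<open>Moving from \<open>v\<close> by \<open>- t *\<^sub>R A v\<close> changes the form by
  \<open>- 2 * t\<close> times the squared norm of \<open>A v\<close>, up to order
  \<open>t\<^sup>2\<close>. For small \<open>t > 0\<close> this would be negative unless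
  \<open>A v = 0\<close>.\<close>

lemma self_adjoint_nonneg_imp_kernel:
  fixes A :: "'a::euclidean_space \<Rightarrow> 'a"
  assumes "linear A" and adj: "\<And>u v. u \<bullet> A v = v \<bullet> A u" and psd: "\<And>v. 0 \<le> v \<bullet> A v"
    and "v \<bullet> A v = 0"
  shows "A v = 0"
proof -
  interpret linear A by fact
  let ?w = "A v"
  have eq: "(v + t *\<^sub>R ?w) \<bullet> A (v + t *\<^sub>R ?w) = 2 * t * (?w \<bullet> ?w) + t\<^sup>2 * (?w \<bullet> A ?w)" for t
    using assms(4) adj[of v "?w"]
    by (simp add: add scaleR inner_add_left inner_add_right power2_eq_square algebra_simps)
  have "0 \<le> - 2 * (?w \<bullet> ?w) + t * (?w \<bullet> A ?w) + t\<^sup>2 * 0" if "t > 0" for t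
  proof -
    have "0 \<le> t * (- 2 * (?w \<bullet> ?w) + t * (?w \<bullet> A ?w))"
      using psd[of "v + (- t) *\<^sub>R ?w"] unfolding eq by (simp add: power2_eq_square algebra_simps)
    then show ?thesis using that by (simp add: zero_le_mult_iff)
  qed
  then have "0 \<le> - 2 * (?w \<bullet> ?w)"
    by (rule nonneg_of_eventually_quadratic_nonneg[OF eventually_mono[OF eventually_at_right_less]])
  then have "?w \<bullet> ?w \<le> 0"
    by simp
  then show ?thesis
    by (metis inner_eq_zero_iff inner_ge_zero order_antisym)
qed

text \<open>The form is strictly positive on the unit sphere of the orthogonal complement, so by
  compactness it has a positive minimum there. Homogeneity of degree two extends the bound to all of
  the complement.\<close>

lemma coercive_orthogonal_kernel:
  fixes A :: "'a::euclidean_space \<Rightarrow> 'a"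
  assumes "linear A" and adj: "\<And>u v. u \<bullet> A v = v \<bullet> A u" and psd: "\<And>v. 0 \<le> v \<bullet> A v"
  obtains l where "l > 0" and "\<And>r. r \<in> {v. A v = 0}\<^sup>\<bottom> \<Longrightarrow> l * (norm r)\<^sup>2 \<le> r \<bullet> A r"
proof -
  interpret linear A by fact
  let ?P = "{v. A v = 0}\<^sup>\<bottom>"
  let ?S = "?P \<inter> sphere 0 1"
  have sub: "subspace ?P"
    by (rule subspace_orthogonal_comp)
  have pos: "0 < r \<bullet> A r" if "r \<in> ?S" for r
  proof (rule ccontr)
    assume "\<not> 0 < r \<bullet> A r"
    then have "r \<bullet> A r = 0" using psd[of r] by simp
    then have "A r = 0"
      using self_adjoint_nonneg_imp_kernel[OF assms] by blast
    \<comment> \<open>\<open>r\<close> lies in the kernel and is orthogonal to it.\<close>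
    then have "r \<bullet> r = 0"
      using that by (auto simp: orthogonal_comp_def orthogonal_def)
    then show False using that by simp
  qed
  obtain l where l: "l > 0" "\<And>r. r \<in> ?S \<Longrightarrow> l \<le> r \<bullet> A r"
  proof (cases "?S = {}")
    \<comment> \<open>The complement is trivial here, so every positive constant works.\<close>
    case True
    then show thesis using that[of 1] by auto
  next
    case False
    have "compact ?S"
      using closed_subspace[OF sub] by (intro closed_Int_compact compact_sphere)
    moreover have "continuous_on ?S (\<lambda>r. r \<bullet> A r)"
      by (intro continuous_intros linear_continuous_on linear_conv_bounded_linear[THEN iffD1] assms)
    ultimately obtain r where "r \<in> ?S" "\<forall>s\<in>?S. r \<bullet> A r \<le> s \<bullet> A s"
      using continuous_attains_inf[OF _ False] by blast
    then show thesis using that[of "r \<bullet> A r"] pos by blast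
  qed
  have "l * (norm r)\<^sup>2 \<le> r \<bullet> A r" if r: "r \<in> ?P" for r
  proof (cases "r = 0")
    case True
    then show ?thesis by simp
  next
    case False
    have "sgn r \<in> ?S"
      using False subspace_scale[OF sub r] by (simp add: sgn_div_norm)
    then have "l \<le> sgn r \<bullet> A (sgn r)" by (rule l)
    also have "\<dots> = (r \<bullet> A r) / (norm r)\<^sup>2"
      by (simp add: sgn_div_norm scaleR power2_eq_square divide_simps)
    finally show ?thesis
      using False by (simp add: field_simps)
  qed
  with l(1) that show thesis by blast
qed

lemma eventually_le_along_curve:
  fixes x :: "'a::real_normed_vector"
  assumes lm: "\<exists>e>0. \<forall>h. norm h \<le> e \<longrightarrow> f x \<le> f (x + h)" and h: "(h \<longlongrightarrow> 0) F"
  shows "\<forall>\<^sub>F t in F. f x \<le> f (x + h t)"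
proof -
  obtain e where "e > 0" and e: "\<And>h. norm h \<le> e \<Longrightarrow> f x \<le> f (x + h)"
    using lm by auto
  have "\<forall>\<^sub>F t in F. norm (h t) < e"
    using tendstoD[OF h \<open>e > 0\<close>] by (simp add: dist_norm)
  then show ?thesis
    by eventually_elim (simp add: e)
qed

text \<open>Dividing by \<open>s > 0\<close> and letting \<open>s\<close> tend to 0 gives
  \<open>0 \<le> b\<close>. The hypothesis at \<open>- s\<close> gives the same for
  \<open>- b\<close>.\<close>

lemma nonneg_quadratic_imp_linear_coeff_zero:
  fixes a b :: real
  assumes "\<And>s. 0 \<le> s * b + s\<^sup>2 * a"
  shows "b = 0"
proof -
  have "0 \<le> c" if *: "\<And>s. 0 \<le> s * c + s\<^sup>2 * a" for c
  proof -
    have "0 \<le> c + s * a + s\<^sup>2 * 0" if "s > 0" for s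
    proof -
      have "s * c + s\<^sup>2 * a = s * (c + s * a)"
        by (simp add: power2_eq_square algebra_simps)
      then show ?thesis
        using *[of s] that by (simp add: zero_le_mult_iff)
    qed
    then show ?thesis
      by (rule nonneg_of_eventually_quadratic_nonneg[OF eventually_mono[OF eventually_at_right_less]])
  qed
  moreover have "0 \<le> s * (- b) + s\<^sup>2 * a" for s
    using assms[of "- s"] by simp
  ultimately have "0 \<le> b" "0 \<le> - b"
    using assms by blast+
  then show ?thesis by simp
qed

section \<open>Necessity and sufficiency for an exact cubic expansion\<close>

context cubic_form
begin

lemma taylor_minimum_necessary:
  fixes f :: "'a \<Rightarrow> real"
  assumes "linear A" and adj: "\<And>u v. u \<bullet> A v = v \<bullet> A u"
    and taylor: "\<And>h. f (x + h) = f x + g \<bullet> h + (h \<bullet> A h) / 2 + h \<bullet> K h h"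
    and lm: "\<exists>e>0. \<forall>h. norm h \<le> e \<longrightarrow> f x \<le> f (x + h)"
  shows "g = 0" and "\<And>v. 0 \<le> v \<bullet> A v" and "\<And>d. A d = 0 \<Longrightarrow> K d d = 0"
proof -
  interpret A: linear A by fact
  have "\<forall>\<^sub>F t in at_right 0. f x \<le> f (x + t *\<^sub>R d)" for d
    by (intro eventually_le_along_curve[OF lm]) (auto intro!: tendsto_eq_intros)
  moreover have "f (x + t *\<^sub>R d) = f x + t * (g \<bullet> d + t * (d \<bullet> A d / 2) + t\<^sup>2 * (d \<bullet> K d d))" for t d
    unfolding taylor cube_scaleR A.scaleR
    by (simp add: power2_eq_square power3_eq_cube algebra_simps)
  ultimately have line: "\<forall>\<^sub>F t in at_right 0. 0 \<le> t * (g \<bullet> d + t * (d \<bullet> A d / 2) + t\<^sup>2 * (d \<bullet> K d d))" for d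
    by simp
  have "\<forall>\<^sub>F t in at_right 0. 0 \<le> g \<bullet> d + t * (d \<bullet> A d / 2) + t\<^sup>2 * (d \<bullet> K d d)" for d
    using line[of d] eventually_at_right_less[of 0]
    by eventually_elim (simp add: zero_le_mult_iff)
  then have "0 \<le> g \<bullet> d" for d
    by (rule nonneg_of_eventually_quadratic_nonneg)
  \<comment> \<open>Steepest descent is the direction to test.\<close>
  from this[of "- g"] have "g \<bullet> g \<le> 0"
    by simp
  then show g: "g = 0"
    by (metis inner_eq_zero_iff inner_ge_zero order_antisym)
  have "\<forall>\<^sub>F t in at_right 0. 0 \<le> d \<bullet> A d / 2 + t * (d \<bullet> K d d) + t\<^sup>2 * 0" for d
    using line[of d] eventually_at_right_less[of 0]
  proof eventually_elim
    case (elim t)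
    then have "0 \<le> t\<^sup>2 * (d \<bullet> A d / 2 + t * (d \<bullet> K d d))"
      by (simp add: g power2_eq_square algebra_simps)
    then show ?case
      using elim by (simp add: zero_le_mult_iff)
  qed
  then have "0 \<le> d \<bullet> A d / 2" for d
    by (rule nonneg_of_eventually_quadratic_nonneg)
  then show "0 \<le> d \<bullet> A d" for d
    by simp
  fix d assume d: "A d = 0"
  have cube: "0 \<le> e \<bullet> K e e" if "A e = 0" for e
  proof -
    have "\<forall>\<^sub>F t in at_right 0. 0 \<le> e \<bullet> K e e + t * 0 + t\<^sup>2 * 0"
      using line[of e] eventually_at_right_less[of 0]
      by eventually_elim (simp add: g that zero_le_mult_iff)
    then show ?thesis
      by (rule nonneg_of_eventually_quadratic_nonneg)
  qed
  \<comment> \<open>The kernel is closed under negation and the cube is odd.\<close>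
  from cube[of d] cube[of "- d"] d have dK: "d \<bullet> K d d = 0"
    by (simp add: A.neg minus_left minus_right)
  have "z \<bullet> K d d = 0" for z
  proof -
    have "0 \<le> s * (3 * (z \<bullet> K d d)) + s\<^sup>2 * (z \<bullet> A z / 2)" for s
    proof -
      let ?h = "\<lambda>t. t *\<^sub>R d + (s * t\<^sup>2) *\<^sub>R z"
      \<comment> \<open>Since \<open>A d = 0\<close> and \<open>A\<close> is self-adjoint, the terms
        of order two and three in \<open>t\<close> drop out.\<close>
      have Ah: "?h t \<bullet> A (?h t) = s\<^sup>2 * t ^ 4 * (z \<bullet> A z)" for t
        using adj[of d z] d
        by (simp add: A.add A.scaleR inner_add_left inner_add_right power2_eq_square power4_eq_xxxx)
      \<comment> \<open>The term of order three is \<open>d \<bullet> K d d\<close>, which is zero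
        by \<open>dK\<close>. Thus the cubic part also starts at order four, where it is linear in
        \<open>s\<close> while the quadratic part is quadratic in \<open>s\<close>.\<close>
      have Kh: "?h t \<bullet> K (?h t) (?h t) = t ^ 4 * (3 * s * (z \<bullet> K d d)
        + t * (3 * s\<^sup>2 * (d \<bullet> K z z)) + t\<^sup>2 * (s ^ 3 * (z \<bullet> K z z)))" for t
        unfolding cube_add
        by (simp add: dK cube_scaleR scaleR_left scaleR_right algebra_simps eval_nat_numeral)
      have "\<forall>\<^sub>F t in at_right 0. f x \<le> f (x + ?h t)"
        by (intro eventually_le_along_curve[OF lm]) (auto intro!: tendsto_eq_intros)
      then have "\<forall>\<^sub>F t in at_right 0. 0 \<le> (s * (3 * (z \<bullet> K d d)) + s\<^sup>2 * (z \<bullet> A z / 2))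
        + t * (3 * s\<^sup>2 * (d \<bullet> K z z)) + t\<^sup>2 * (s ^ 3 * (z \<bullet> K z z))"
        using eventually_at_right_less[of 0]
      proof eventually_elim
        case (elim t)
        then have "0 \<le> t ^ 4 * ((s * (3 * (z \<bullet> K d d)) + s\<^sup>2 * (z \<bullet> A z / 2))
          + t * (3 * s\<^sup>2 * (d \<bullet> K z z)) + t\<^sup>2 * (s ^ 3 * (z \<bullet> K z z)))"
          unfolding taylor Ah Kh g by (simp add: algebra_simps)
        then show ?case
          using elim by (simp add: zero_le_mult_iff)
      qed
      then show ?thesis
        by (rule nonneg_of_eventually_quadratic_nonneg)
    qed
    then have "3 * (z \<bullet> K d d) = 0"
      by (rule nonneg_quadratic_imp_linear_coeff_zero)
    then show ?thesis by simp
  qed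
  then show "K d d = 0"
    by (metis inner_eq_zero_iff)
qed

lemma taylor_minimum_sufficient:
  fixes f :: "'a \<Rightarrow> real"
  assumes "linear A" and adj: "\<And>u v. u \<bullet> A v = v \<bullet> A u"
    and taylor: "\<And>h. f (x + h) = f x + (h \<bullet> A h) / 2 + h \<bullet> K h h"
    and psd: "\<And>v. 0 \<le> v \<bullet> A v" and ker: "\<And>d. A d = 0 \<Longrightarrow> K d d = 0"
  shows "\<exists>e>0. \<forall>h. norm h \<le> e \<longrightarrow> f x \<le> f (x + h)"
proof -
  interpret A: linear A by fact
  let ?N = "{v. A v = 0}"
  have N: "subspace ?N"
    using assms(1) by (rule linear_subspace_kernel)
  obtain l where "l > 0" and l: "\<And>r. r \<in> ?N\<^sup>\<bottom> \<Longrightarrow> l * (norm r)\<^sup>2 \<le> r \<bullet> A r"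
    using coercive_orthogonal_kernel[OF assms(1) adj psd] by blast
  obtain C where "C > 0" and C: "\<And>a b. norm (K a b) \<le> norm a * norm b * C"
    using pos_bounded by blast
  \<comment> \<open>The radius makes the cubic bound
    \<open>4 * norm h * C * (norm r)\<^sup>2\<close> at most
    \<open>l * (norm r)\<^sup>2 / 2\<close>, which is what half of \<open>r \<bullet> A r\<close>
    can absorb.\<close>
  have "f x \<le> f (x + h)" if h: "norm h \<le> l / (8 * C)" for h
  proof -
    obtain d r where d: "d \<in> span ?N" and r: "\<And>w. w \<in> span ?N \<Longrightarrow> orthogonal r w" and hdr: "h = d + r"
      using orthogonal_subspace_decomp_exists[of ?N h] by blast
    have Ad: "A d = 0"
      using d N by (simp add: span_eq_iff[THEN iffD2])
    have "r \<in> ?N\<^sup>\<bottom>"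
      using r by (auto simp: orthogonal_comp_def span_base orthogonal_commute)
    then have lr: "l * (norm r)\<^sup>2 \<le> r \<bullet> A r" by (rule l)
    have "orthogonal d r"
      using r[OF d] by (simp add: orthogonal_commute)
    then have "(norm h)\<^sup>2 = (norm d)\<^sup>2 + (norm r)\<^sup>2"
      unfolding hdr by (rule norm_add_Pythagorean)
    then have nd: "norm d \<le> norm h" and nr: "norm r \<le> norm h"
      by (auto intro: power2_le_imp_le)
    have Ah: "h \<bullet> A h = r \<bullet> A r"
      using adj[of d r] by (simp add: hdr A.add Ad inner_add_left)
    \<comment> \<open>Both \<open>d \<bullet> K d d\<close> and
      \<open>3 * (r \<bullet> K d d)\<close> vanish with \<open>K d d\<close>; the remaining terms
      are at least quadratic in \<open>r\<close>.\<close>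
    have "h \<bullet> K h h = (3 *\<^sub>R d + r) \<bullet> K r r"
      unfolding hdr cube_add using ker[OF Ad] by (simp add: inner_add_left)
    also have "\<bar>\<dots>\<bar> \<le> norm (3 *\<^sub>R d + r) * norm (K r r)"
      by (rule Cauchy_Schwarz_ineq2)
    also have "\<dots> \<le> (4 * norm h) * (norm r * norm r * C)"
    proof (intro mult_mono C)
      show "norm (3 *\<^sub>R d + r) \<le> 4 * norm h"
        using norm_triangle_ineq[of "3 *\<^sub>R d" r] nd nr by simp
    qed simp_all
    also have "\<dots> \<le> (4 * (l / (8 * C))) * (norm r * norm r * C)"
      using h \<open>C > 0\<close> by (intro mult_right_mono mult_left_mono) auto
    also have "\<dots> = l * (norm r)\<^sup>2 / 2"
      using \<open>C > 0\<close> by (simp add: power2_eq_square)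
    finally show ?thesis
      using lr unfolding taylor Ah by linarith
  qed
  moreover have "0 < l / (8 * C)"
    using \<open>l > 0\<close> \<open>C > 0\<close> by simp
  ultimately show ?thesis by blast
qed

end

lemma local_minimum_iff_add:
  "local_minimum f x \<longleftrightarrow> (\<exists>e>0. \<forall>h. norm h \<le> e \<longrightarrow> f x \<le> f (x + h))"
  unfolding local_minimum_def by (metis add.commute add_diff_cancel_left' diff_add_cancel)

section \<open>Decomposition of cubic polynomials\<close>

text \<open>Tying \<open>f\<close> and its cubic part \<open>c\<close> to the same \<open>K\<close>
  gives a relation closed under linear combinations, so that only monomials need to be examined. The
  quadratic term has no factor 1/2, hence \<open>M\<close> contributes \<open>2 *\<^sub>R M\<close>
  to the Hessian.\<close>

definition has_cubic_part :: "(real ^ 'n \<Rightarrow> real) \<Rightarrow> (real ^ 'n \<Rightarrow> real) \<Rightarrow> bool"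
  where "has_cubic_part f c \<longleftrightarrow> (\<exists>a l M K. linear M \<and> (\<forall>u v. u \<bullet> M v = v \<bullet> M u) \<and> cubic_form K \<and>
    f = (\<lambda>x. a + l \<bullet> x + x \<bullet> M x + x \<bullet> K x x) \<and> c = (\<lambda>x. x \<bullet> K x x))"

lemma has_cubic_partI:
  assumes "linear M" "\<And>u v. u \<bullet> M v = v \<bullet> M u" "cubic_form K"
    and "\<And>x. f x = a + l \<bullet> x + x \<bullet> M x + x \<bullet> K x x" "\<And>x. c x = x \<bullet> K x x"
  shows "has_cubic_part f c"
  unfolding has_cubic_part_def using assms by blast

lemma has_cubic_part_affine: "has_cubic_part (\<lambda>x. a + l \<bullet> x) (\<lambda>x. 0)"
  by (rule has_cubic_partI[where M = "\<lambda>_. 0", OF _ _ cubic_form_zero]) (simp_all add: linear_iff)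

lemma has_cubic_part_add:
  assumes "has_cubic_part f c" "has_cubic_part g d"
  shows "has_cubic_part (\<lambda>x. f x + g x) (\<lambda>x. c x + d x)"
proof -
  obtain a l M K where 1: "linear M" "\<And>u v. u \<bullet> M v = v \<bullet> M u" "cubic_form K"
    "f = (\<lambda>x. a + l \<bullet> x + x \<bullet> M x + x \<bullet> K x x)" "c = (\<lambda>x. x \<bullet> K x x)"
    using assms(1) unfolding has_cubic_part_def by blast
  obtain a' l' M' K' where 2: "linear M'" "\<And>u v. u \<bullet> M' v = v \<bullet> M' u" "cubic_form K'"
    "g = (\<lambda>x. a' + l' \<bullet> x + x \<bullet> M' x + x \<bullet> K' x x)" "d = (\<lambda>x. x \<bullet> K' x x)"
    using assms(2) unfolding has_cubic_part_def by blast
  show ?thesis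
  proof (rule has_cubic_partI[OF _ _ cubic_form_add[OF 1(3) 2(3)]])
    show "linear (\<lambda>x. M x + M' x)"
      using 1(1) 2(1) by (rule linear_compose_add)
    show "u \<bullet> (M v + M' v) = v \<bullet> (M u + M' u)" for u v
      using 1(2)[of u v] 2(2)[of u v] by (simp add: inner_add_right)
    show "f x + g x = (a + a') + (l + l') \<bullet> x + x \<bullet> (M x + M' x) + x \<bullet> (K x x + K' x x)" for x
      by (simp add: 1(4) 2(4) inner_add_left inner_add_right)
    show "c x + d x = x \<bullet> (K x x + K' x x)" for x
      by (simp add: 1(5) 2(5) inner_add_right)
  qed
qed

lemma has_cubic_part_scale:
  assumes "has_cubic_part f c"
  shows "has_cubic_part (\<lambda>x. k * f x) (\<lambda>x. k * c x)"
proof -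
  obtain a l M K where 1: "linear M" "\<And>u v. u \<bullet> M v = v \<bullet> M u" "cubic_form K"
    "f = (\<lambda>x. a + l \<bullet> x + x \<bullet> M x + x \<bullet> K x x)" "c = (\<lambda>x. x \<bullet> K x x)"
    using assms(1) unfolding has_cubic_part_def by blast
  show ?thesis
  proof (rule has_cubic_partI[OF _ _ cubic_form_scaleR[OF 1(3), of k]])
    show "linear (\<lambda>x. k *\<^sub>R M x)"
      using 1(1) by (rule linear_compose_scale_right)
    show "u \<bullet> k *\<^sub>R M v = v \<bullet> k *\<^sub>R M u" for u v
      using 1(2)[of u v] by simp
    show "k * f x = k * a + (k *\<^sub>R l) \<bullet> x + x \<bullet> k *\<^sub>R M x + x \<bullet> k *\<^sub>R K x x" for x
      by (simp add: 1(4) algebra_simps)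
    show "k * c x = x \<bullet> k *\<^sub>R K x x" for x
      by (simp add: 1(5))
  qed
qed

lemma has_cubic_part_sum:
  assumes "finite I" "\<And>i. i \<in> I \<Longrightarrow> has_cubic_part (f i) (c i)"
  shows "has_cubic_part (\<lambda>x. \<Sum>i\<in>I. f i x) (\<lambda>x. \<Sum>i\<in>I. c i x)"
  using assms
proof (induction I rule: finite_induct)
  case empty
  then show ?case using has_cubic_part_affine[of 0 0] by simp
next
  case (insert i I)
  then show ?case by (simp add: has_cubic_part_add)
qed

lemma has_cubic_part_quadratic_monomial: "has_cubic_part (\<lambda>x. x $ i * x $ j) (\<lambda>x. 0)"
proof (rule has_cubic_partI[OF _ _ cubic_form_zero])
  \<comment> \<open>Polarization: the average over both orders of \<open>i\<close> and
    \<open>j\<close>. The indices may coincide.\<close>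
  let ?M = "\<lambda>x :: real ^ 'a. (x $ j / 2) *\<^sub>R axis i 1 + (x $ i / 2) *\<^sub>R axis j 1"
  show "linear ?M"
    by (simp add: linear_iff algebra_simps add_divide_distrib)
  show "u \<bullet> ?M v = v \<bullet> ?M u" for u v
    by (simp add: inner_add_right inner_axis mult.commute)
  show "x $ i * x $ j = 0 + 0 \<bullet> x + x \<bullet> ?M x + x \<bullet> 0" for x
    by (simp add: inner_add_right inner_axis)
qed simp

lemma has_cubic_part_cubic_monomial:
  "has_cubic_part (\<lambda>x. x $ i * (x $ j * x $ k)) (\<lambda>x. x $ i * (x $ j * x $ k))"
proof (rule has_cubic_partI[where M = "\<lambda>_. 0" and a = 0 and l = 0])
  \<comment> \<open>Polarization again: \<open>x \<bullet> ?K y z\<close> averages the product of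
    coordinates over the six permutations of \<open>i\<close>, \<open>j\<close>, \<open>k\<close>,
    whether or not these are distinct.\<close>
  let ?K = "\<lambda>x y :: real ^ 'a. ((x $ j * y $ k + x $ k * y $ j) / 6) *\<^sub>R axis i 1
    + ((x $ i * y $ k + x $ k * y $ i) / 6) *\<^sub>R axis j 1
    + ((x $ i * y $ j + x $ j * y $ i) / 6) *\<^sub>R axis k 1"
  have eq: "x \<bullet> ?K y z = (x $ i * (y $ j * z $ k + y $ k * z $ j) + x $ j * (y $ i * z $ k + y $ k * z $ i)
    + x $ k * (y $ i * z $ j + y $ j * z $ i)) / 6" for x y z
    by (simp add: inner_add_right inner_axis field_simps)
  show "cubic_form ?K"
  proof (rule cubic_formI)
    show "x \<bullet> ?K y z = y \<bullet> ?K x z" for x y z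
      unfolding eq by (simp add: algebra_simps)
    show "?K (y + y') z = ?K y z + ?K y' z" for y y' z
      by (simp add: algebra_simps add_divide_distrib)
    show "?K (c *\<^sub>R y) z = c *\<^sub>R ?K y z" for c y z
      by (simp add: algebra_simps add_divide_distrib)
  qed (simp add: algebra_simps)
  show "x $ i * (x $ j * x $ k) = 0 + 0 \<bullet> x + x \<bullet> 0 + x \<bullet> ?K x x" for x
    unfolding eq by simp
  show "x $ i * (x $ j * x $ k) = x \<bullet> ?K x x" for x
    unfolding eq by simp
qed (simp_all add: linear_iff)

section \<open>Monomials and homogeneous components\<close>

definition monomial_eval :: "'n::finite monomial \<Rightarrow> real ^ 'n \<Rightarrow> real"
  where "monomial_eval m x = (\<Prod>i\<in>UNIV. (x $ i) ^ Poly_Mapping.lookup m i)"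

lemma monomial_eval_degree_0:
  assumes "monomial_degree m = 0"
  shows "monomial_eval m = (\<lambda>x. 1)"
  using assms by (auto simp: monomial_degree_def monomial_eval_def fun_eq_iff)

text \<open>Lowering a nonzero exponent by one splits off one variable. Iteration turns a monomial
  into a product of coordinates, possibly repeated.\<close>

lemma monomial_eval_degree_Suc:
  assumes "monomial_degree m = Suc k"
  obtains i m' where "monomial_degree m' = k" "monomial_eval m = (\<lambda>x. x $ i * monomial_eval m' x)"
proof -
  have "\<exists>i. Poly_Mapping.lookup m i \<noteq> 0"
    using assms unfolding monomial_degree_def by (metis sum.neutral nat.distinct(1))
  then obtain i n where i: "Poly_Mapping.lookup m i = Suc n"
    using not0_implies_Suc by blast
  let ?m = "Poly_Mapping.update i n m"
  have lookup: "Poly_Mapping.lookup ?m j = (if j = i then n else Poly_Mapping.lookup m j)" for j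
    by (simp add: lookup_update)
  have "monomial_degree m = Suc (monomial_degree ?m)"
    unfolding monomial_degree_def by (simp add: sum.remove[of UNIV i] lookup i)
  then have "monomial_degree ?m = k"
    using assms by simp
  moreover have "monomial_eval m = (\<lambda>x. x $ i * monomial_eval ?m x)"
    unfolding monomial_eval_def by (simp add: prod.remove[of UNIV i] lookup i mult.assoc)
  ultimately show thesis by (rule that)
qed

lemma has_cubic_part_monomial:
  assumes "monomial_degree m \<le> 3"
  shows "has_cubic_part (monomial_eval m) (\<lambda>x. if monomial_degree m = 3 then monomial_eval m x else 0)"
proof -
  \<comment> \<open>Degrees are in successor form so that variables can be split off one at a
    time.\<close>
  consider "monomial_degree m = 0" | "monomial_degree m = Suc 0" | "monomial_degree m = Suc (Suc 0)"
    | "monomial_degree m = Suc (Suc (Suc 0))"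
    using assms by linarith
  then show ?thesis
  proof cases
    case 1
    then show ?thesis
      using has_cubic_part_affine[of 1 0] by (simp add: monomial_eval_degree_0)
  next
    case 2
    then obtain i m1 where "monomial_degree m1 = 0" "monomial_eval m = (\<lambda>x. x $ i * monomial_eval m1 x)"
      by (rule monomial_eval_degree_Suc)
    then have "monomial_eval m = (\<lambda>x. 0 + axis i 1 \<bullet> x)"
      by (simp add: monomial_eval_degree_0 inner_axis')
    with 2 show ?thesis
      using has_cubic_part_affine[of 0 "axis i 1"] by simp
  next
    case 3
    then obtain i m1 where m1: "monomial_degree m1 = Suc 0"
        "monomial_eval m = (\<lambda>x. x $ i * monomial_eval m1 x)"
      by (rule monomial_eval_degree_Suc)
    from m1(1) obtain j m2 where "monomial_degree m2 = 0"
        "monomial_eval m1 = (\<lambda>x. x $ j * monomial_eval m2 x)"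
      by (rule monomial_eval_degree_Suc)
    with 3 m1 show ?thesis
      using has_cubic_part_quadratic_monomial[of i j] by (simp add: monomial_eval_degree_0)
  next
    case 4
    then obtain i m1 where m1: "monomial_degree m1 = Suc (Suc 0)"
        "monomial_eval m = (\<lambda>x. x $ i * monomial_eval m1 x)"
      by (rule monomial_eval_degree_Suc)
    from m1(1) obtain j m2 where m2: "monomial_degree m2 = Suc 0"
        "monomial_eval m1 = (\<lambda>x. x $ j * monomial_eval m2 x)"
      by (rule monomial_eval_degree_Suc)
    from m2(1) obtain k m3 where "monomial_degree m3 = 0"
        "monomial_eval m2 = (\<lambda>x. x $ k * monomial_eval m3 x)"
      by (rule monomial_eval_degree_Suc)
    with 4 m1 m2 show ?thesis
      using has_cubic_part_cubic_monomial[of i j k] by (simp add: monomial_eval_degree_0 eval_nat_numeral)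
  qed
qed

lemma lookup_homogeneous_component:
  "Poly_Mapping.lookup (homogeneous_component k p) m =
    (if monomial_degree m = k then Poly_Mapping.lookup p m else 0)"
proof -
  have "Poly_Mapping.lookup (homogeneous_component k p) m =
      (\<Sum>m'\<in>{m \<in> Poly_Mapping.keys p. monomial_degree m = k}.
        if m' = m then Poly_Mapping.lookup p m else 0)"
    unfolding homogeneous_component_def lookup_sum
    by (intro sum.cong) (auto simp: lookup_single)
  then show ?thesis
    by (auto simp: in_keys_iff)
qed

text \<open>Summing over the keys of \<open>p\<close> itself, with zeros in the other degrees, lets
  \<open>p\<close> and its component be built up by the same sum.\<close>

lemma mpoly_eval_homogeneous_component:
  "mpoly_eval (homogeneous_component k p) x = (\<Sum>m\<in>Poly_Mapping.keys p.
    Poly_Mapping.lookup p m * (if monomial_degree m = k then monomial_eval m x else 0))"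
  unfolding mpoly_eval_def monomial_eval_def[symmetric]
  by (rule sum.mono_neutral_cong_left)
    (auto simp: in_keys_iff lookup_homogeneous_component split: if_splits)

lemma has_cubic_part_mpoly_eval:
  assumes "cubic_mpoly p"
  shows "has_cubic_part (mpoly_eval p) (mpoly_eval (homogeneous_component 3 p))"
proof -
  have "has_cubic_part
    (\<lambda>x. \<Sum>m\<in>Poly_Mapping.keys p. Poly_Mapping.lookup p m * monomial_eval m x)
    (\<lambda>x. \<Sum>m\<in>Poly_Mapping.keys p. Poly_Mapping.lookup p m *
      (if monomial_degree m = 3 then monomial_eval m x else 0))"
    using assms
    by (intro has_cubic_part_sum has_cubic_part_scale has_cubic_part_monomial)
      (simp_all add: cubic_mpoly_def)
  moreover have "mpoly_eval p =
      (\<lambda>x. \<Sum>m\<in>Poly_Mapping.keys p. Poly_Mapping.lookup p m * monomial_eval m x)"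
    by (simp add: mpoly_eval_def monomial_eval_def fun_eq_iff)
  moreover have "mpoly_eval (homogeneous_component 3 p) = (\<lambda>x. \<Sum>m\<in>Poly_Mapping.keys p.
      Poly_Mapping.lookup p m * (if monomial_degree m = 3 then monomial_eval m x else 0))"
    by (simp add: mpoly_eval_homogeneous_component fun_eq_iff)
  ultimately show ?thesis by simp
qed

section \<open>Gradient, Hessian and Taylor expansion of a cubic polynomial\<close>

lemma transpose_eq_selfI:
  fixes A :: "real ^ 'n ^ 'n"
  assumes "\<And>u v. u \<bullet> (A *v v) = v \<bullet> (A *v u)"
  shows "transpose A = A"
proof -
  have "axis i 1 \<bullet> (A *v axis j 1) = A $ i $ j" for i j
    by (simp add: matrix_vector_mult_basis inner_axis' column_def)
  then have "A $ i $ j = A $ j $ i" for i j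
    using assms by metis
  then show ?thesis
    by (simp add: transpose_def vec_eq_iff)
qed

theorem theorem3p1:
  fixes p :: "'n::finite real_mpoly" and xbar :: "real ^ 'n"
  assumes "cubic_mpoly p"
  shows "local_minimum (mpoly_eval p) xbar \<longleftrightarrow>
    gradient (mpoly_eval p) xbar = 0 \<and>
    pos_semidef (hessian (mpoly_eval p) xbar) \<and>
    (\<forall>d \<in> null_space (hessian (mpoly_eval p) xbar).
      gradient (mpoly_eval (homogeneous_component 3 p)) d = 0)" (is "?L \<longleftrightarrow> ?R")
proof -
  obtain a l M K where M: "linear M" "\<And>u v. u \<bullet> M v = v \<bullet> M u" and K: "cubic_form K"
    and f: "mpoly_eval p = (\<lambda>x. a + l \<bullet> x + x \<bullet> M x + x \<bullet> K x x)"
    and c: "mpoly_eval (homogeneous_component 3 p) = (\<lambda>x. x \<bullet> K x x)"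
    using has_cubic_part_mpoly_eval[OF assms] unfolding has_cubic_part_def by blast
  interpret M: linear M by fact
  interpret cubic_form K by fact
  have M': "(M has_derivative M) (at x)" for x
    using M(1) by (simp add: linear_conv_bounded_linear bounded_linear_imp_has_derivative)
  let ?G = "\<lambda>x. l + 2 *\<^sub>R M x + 3 *\<^sub>R K x x"
  \<comment> \<open>Differentiating \<open>3 *\<^sub>R K x x\<close> gives two equal terms, hence
    the factor 6.\<close>
  let ?A = "\<lambda>h. 2 *\<^sub>R M h + 6 *\<^sub>R K xbar h"
  have "GDERIV (mpoly_eval p) x :> ?G x" for x
    unfolding gderiv_def f
  proof (rule has_derivative_eq_rhs)
    let ?D = "\<lambda>h. 0 + (l \<bullet> h + 0 \<bullet> x) + (x \<bullet> M h + h \<bullet> M x) + 3 * (h \<bullet> K x x)"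
    show "((\<lambda>x. a + l \<bullet> x + x \<bullet> M x + x \<bullet> K x x) has_derivative ?D) (at x)"
      by (intro has_derivative_add has_derivative_const has_derivative_cube
          has_derivative_inner has_derivative_ident M')
    show "?D = (\<lambda>h. h \<bullet> ?G x)"
      using M(2)[of x] by (simp add: fun_eq_iff inner_add_right inner_commute)
  qed
  then have G: "gradient (mpoly_eval p) = ?G"
    by (intro ext gradient_eqI)
  \<comment> \<open>This translates the third condition into \<open>K d d = 0\<close> on the kernel
    of \<open>?A\<close>.\<close>
  have gradc: "gradient (mpoly_eval (homogeneous_component 3 p)) d = 3 *\<^sub>R K d d" for d
    using has_derivative_cube[of d] by (intro gradient_eqI) (simp add: c gderiv_def)
  have "(?G has_derivative ?A) (at xbar)"
  proof (rule has_derivative_eq_rhs)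
    show "(?G has_derivative (\<lambda>h. 0 + 2 *\<^sub>R M h + 3 *\<^sub>R (K xbar h + K h xbar))) (at xbar)"
      by (intro has_derivative_add has_derivative_const has_derivative_scaleR_right M' FDERIV
          has_derivative_ident)
    show "(\<lambda>h. 0 + 2 *\<^sub>R M h + 3 *\<^sub>R (K xbar h + K h xbar)) = ?A"
      using commute[of _ xbar] by (simp flip: scaleR_2)
  qed
  moreover have A: "linear ?A"
    by (simp add: linear_iff M.add M.scaleR add_right scaleR_right algebra_simps)
  ultimately have H: "hessian (mpoly_eval p) xbar *v h = ?A h" for h
    by (simp add: hessian_def jacobian_def G frechet_derivative_at[symmetric] matrix_works)
  have adj: "u \<bullet> ?A v = v \<bullet> ?A u" for u v
    using M(2)[of u v] adjoint[of u xbar v] adjoint[of v xbar u] adjoint[of xbar u v] commute[of u v]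
    by (simp add: inner_add_right)
  \<comment> \<open>The expansion is exact: the term \<open>3 * (xbar \<bullet> K h h)\<close> from
    \<open>cube_add\<close> equals half of \<open>6 * (h \<bullet> K xbar h)\<close> by
    symmetry.\<close>
  have taylor: "mpoly_eval p (xbar + h) =
      mpoly_eval p xbar + ?G xbar \<bullet> h + (h \<bullet> ?A h) / 2 + h \<bullet> K h h" for h
    using M(2)[of h xbar] adjoint[of xbar h h] commute[of xbar h]
    unfolding f cube_add by (simp add: M.add inner_add_left inner_add_right inner_commute)
  have symm: "transpose (hessian (mpoly_eval p) xbar) = hessian (mpoly_eval p) xbar"
    by (rule transpose_eq_selfI) (simp only: H adj)
  show "?L \<longleftrightarrow> ?R"
  proof
    assume "local_minimum (mpoly_eval p) xbar"
    from taylor_minimum_necessary[OF A adj taylor this[unfolded local_minimum_iff_add]] symm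
    show ?R
      by (simp add: pos_semidef_def null_space_def G gradc H)
  next
    assume *: ?R
    show "local_minimum (mpoly_eval p) xbar"
      unfolding local_minimum_iff_add
    proof (rule taylor_minimum_sufficient[OF A adj])
      show "mpoly_eval p (xbar + h) = mpoly_eval p xbar + h \<bullet> ?A h / 2 + h \<bullet> K h h" for h
        using taylor[of h] * by (simp add: G)
      show "0 \<le> v \<bullet> ?A v" for v
        using * by (simp add: pos_semidef_def H)
      show "K d d = 0" if "?A d = 0" for d
        using * that by (simp add: null_space_def gradc H)
    qed
  qed
qed

end
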